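(* Let $\Delta$ be a thick polar space of rank $3$, let $p,b$ be two opposite points of $\Delta$, and let $\Gamma$ be the generalized quadrangle $p^\perp\cap b^\perp$. Then all roots of the first kind of $\Gamma$ are Moufang. Furthermore, every root elation of $\Gamma$ fixing the interior of a root of the first kind can be written as a self-projectivity of length $4$; that is, for every such root elation $\theta$ there are points $p_0=p,p_1,p_2,p_3,p_4=p$ of $\Delta$ with $p_{i-1}$ opposite $p_i$ for $i=1,\dots,4$ such that, under the identification of $\Gamma$ with $\mathrm{Res}_\Delta(p)$ given by $x\mapsto px$, $\theta$ is the collineation $\mathrm{proj}^{p_3}_{p_4}\circ\mathrm{proj}^{p_2}_{p_3}\circ\mathrm{proj}^{p_1}_{p_2}\circ\mathrm{proj}^{p_0}_{p_1}$.
   Context: A point-line geometry is a set of points with a set of lines (subsets of the point set). Points $x,y$ on a common line are collinear, $x\perp y$ (each point is collinear to itself); $x^\perp$ is the set of points collinear to $x$. A (non-degenerate) polar space is a point-line geometry in which every line has at least three points and, for every point $x$, $x^\perp$ is a proper subspace (closed under lines meeting it in at least two points, not everything) meeting every line. Singular subspaces are subspaces of pairwise collinear points. Rank $3$: the maximal singular subspaces are projective planes. Thick: every line is contained in at least three planes. Two points are opposite if not collinear. For opposite points $p,b$, the set $p^\perp\cap b^\perp$ with the lines contained in it is a thick generalized quadrangle (polar space of rank 2). Residues and projectivities. For a point $p$, $\mathrm{Res}_\Delta(p)$ is the geometry whose points are the lines of $\Delta$ through $p$ and whose lines are the planes of $\Delta$ through $p$. For opposite points $p,b$, $\mathrm{proj}^p_b:\mathrm{Res}_\Delta(p)\to\mathrm{Res}_\Delta(b)$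 maps a line $K$ through $p$ to the line $bu'$, where $u'$ is the unique point of $K$ collinear to $b$. A composition $\mathrm{proj}^{p_{s-1}}_{p_s}\circ\cdots\circ\mathrm{proj}^{p_0}_{p_1}$ (consecutive points opposite) is a projectivity of length $s$; it is a self-projectivity if $p_s=p_0$. The map $x\mapsto px$ is an isomorphism $\Gamma\to\mathrm{Res}_\Delta(p)$ for $\Gamma=p^\perp\cap b^\perp$. Roots of the first kind in $\Gamma$. An apartment of $\Gamma$ is an ordinary quadrangle: four points $d,q,u,n$ with $d\perp q\perp u\perp n\perp d$, $d\not\perp u$, $q\not\perp n$, together with the four lines $dq,qu,un,nd$. A root of the first kind in this apartment is $\alpha=\{d,q,n,dq,dn\}$, with interior $\alpha^+=\{d,dq,dn\}$. A root elation for $\alpha$ is a collineation of $\Gamma$ fixing every point of $dq$ and of $dn$ and stabilizing every line through $d$. The root $\alpha$ is Moufang if the group of root elations for $\alpha$ acts transitively on the set of apartments of $\Gamma$ containing $\alpha$. A collineation is a permutation of points inducing a permutation of lines. *)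

theory Defs
  imports Main "HOL-Library.FuncSet"
begin

record 'a geometry =
  points :: "'a set"
  lines :: "'a set set"

definition is_geometry :: "'a geometry \<Rightarrow> bool" where
  "is_geometry G \<longleftrightarrow> (\<forall>l\<in>lines G. l \<subseteq> points G)"

definition collin :: "'a geometry \<Rightarrow> 'a \<Rightarrow> 'a \<Rightarrow> bool" where
  "collin G x y \<longleftrightarrow> x \<in> points G \<and> y \<in> points G \<and> (x = y \<or> (\<exists>l\<in>lines G. x \<in> l \<and> y \<in> l))"

definition perp :: "'a geometry \<Rightarrow> 'a \<Rightarrow> 'a set" where
  "perp G x = {y. collin G x y}"

definition opposite :: "'a geometry \<Rightarrow> 'a \<Rightarrow> 'a \<Rightarrow> bool" where
  "opposite G x y \<longleftrightarrow> x \<in> points G \<and> y \<in> points G \<and> \<not> collin G x y"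

(* Only meaningful for distinct collinear points; in a polar space (and in its subgeometries)
   two such points lie on a unique line. *)
definition join :: "'a geometry \<Rightarrow> 'a \<Rightarrow> 'a \<Rightarrow> 'a set" where
  "join G x y = (THE l. l \<in> lines G \<and> x \<in> l \<and> y \<in> l)"

(* Used instead of a bound on card, since lines may be infinite. *)
definition at_least_three :: "'b set \<Rightarrow> bool" where
  "at_least_three S \<longleftrightarrow> (\<exists>x\<in>S. \<exists>y\<in>S. \<exists>z\<in>S. x \<noteq> y \<and> x \<noteq> z \<and> y \<noteq> z)"

definition subspace :: "'a geometry \<Rightarrow> 'a set \<Rightarrow> bool" where
  "subspace G S \<longleftrightarrow> S \<subseteq> points G \<and>
     (\<forall>l\<in>lines G. (\<exists>x\<in>l \<inter> S. \<exists>y\<in>l \<inter> S. x \<noteq> y) \<longrightarrow> l \<subseteq> S)"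

definition induced :: "'a geometry \<Rightarrow> 'a set \<Rightarrow> 'a geometry" where
  "induced G S = \<lparr>points = S, lines = {l \<in> lines G. l \<subseteq> S}\<rparr>"

definition polar_space :: "'a geometry \<Rightarrow> bool" where
  "polar_space G \<longleftrightarrow> is_geometry G \<and>
     (\<forall>l\<in>lines G. at_least_three l) \<and>
     (\<forall>x\<in>points G. subspace G (perp G x) \<and> perp G x \<noteq> points G \<and>
        (\<forall>l\<in>lines G. perp G x \<inter> l \<noteq> {}))"

definition singular_subspace :: "'a geometry \<Rightarrow> 'a set \<Rightarrow> bool" where
  "singular_subspace G S \<longleftrightarrow> subspace G S \<and> (\<forall>x\<in>S. \<forall>y\<in>S. collin G x y)"

definition maximal_singular_subspace :: "'a geometry \<Rightarrow> 'a set \<Rightarrow> bool" where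
  "maximal_singular_subspace G S \<longleftrightarrow> singular_subspace G S \<and>
     (\<forall>T. singular_subspace G T \<and> S \<subseteq> T \<longrightarrow> T = S)"

definition projective_plane :: "'a geometry \<Rightarrow> bool" where
  "projective_plane G \<longleftrightarrow> is_geometry G \<and>
     (\<forall>x\<in>points G. \<forall>y\<in>points G. x \<noteq> y \<longrightarrow> (\<exists>!l. l \<in> lines G \<and> x \<in> l \<and> y \<in> l)) \<and>
     (\<forall>l\<in>lines G. \<forall>m\<in>lines G. l \<noteq> m \<longrightarrow> (\<exists>!x. x \<in> l \<and> x \<in> m)) \<and>
     (\<exists>S\<subseteq>points G. card S = 4 \<and> (\<forall>l\<in>lines G. \<not> at_least_three (l \<inter> S)))"

definition plane :: "'a geometry \<Rightarrow> 'a set \<Rightarrow> bool" where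
  "plane G S \<longleftrightarrow> singular_subspace G S \<and> projective_plane (induced G S)"

definition polar_rank3 :: "'a geometry \<Rightarrow> bool" where
  "polar_rank3 G \<longleftrightarrow> (\<forall>S. maximal_singular_subspace G S \<longrightarrow> projective_plane (induced G S))"

definition thick_polar_rank3 :: "'a geometry \<Rightarrow> bool" where
  "thick_polar_rank3 G \<longleftrightarrow> polar_space G \<and> polar_rank3 G \<and>
     (\<forall>l\<in>lines G. at_least_three {S. plane G S \<and> l \<subseteq> S})"

definition perp_quadrangle :: "'a geometry \<Rightarrow> 'a \<Rightarrow> 'a \<Rightarrow> 'a geometry" where
  "perp_quadrangle G p b = induced G (perp G p \<inter> perp G b)"

(* A plane S through p is encoded as the pencil of lines through p in S, so that lines of the
   residue are subsets of its point set. *)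
definition residue :: "'a geometry \<Rightarrow> 'a \<Rightarrow> 'a set geometry" where
  "residue G p = \<lparr>points = {K \<in> lines G. p \<in> K},
     lines = {{K \<in> lines G. p \<in> K \<and> K \<subseteq> S} | S. plane G S \<and> p \<in> S}\<rparr>"

definition proj :: "'a geometry \<Rightarrow> 'a \<Rightarrow> 'a \<Rightarrow> 'a set \<Rightarrow> 'a set" where
  "proj G p b = (\<lambda>K\<in>points (residue G p). join G b (THE u. u \<in> K \<and> collin G u b))"

definition collineation :: "'a geometry \<Rightarrow> ('a \<Rightarrow> 'a) \<Rightarrow> bool" where
  "collineation G f \<longleftrightarrow> bij_betw f (points G) (points G) \<and> bij_betw (image f) (lines G) (lines G)"

(* The quadrangle is d, q, u, n in cyclic order; distinctness of the points is implied. *)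
definition quadrangle :: "'a geometry \<Rightarrow> 'a \<Rightarrow> 'a \<Rightarrow> 'a \<Rightarrow> 'a \<Rightarrow> bool" where
  "quadrangle G d q u n \<longleftrightarrow>
     collin G d q \<and> collin G q u \<and> collin G u n \<and> collin G n d \<and>
     opposite G d u \<and> opposite G q n"

(* Apartments and roots are sets of points and lines, i.e. subsets of a disjoint sum. *)
definition apartment_of ::
  "'a geometry \<Rightarrow> 'a \<Rightarrow> 'a \<Rightarrow> 'a \<Rightarrow> 'a \<Rightarrow> ('a + 'a set) set" where
  "apartment_of G d q u n = {d, q, u, n} <+> {join G d q, join G q u, join G u n, join G n d}"

definition apartments :: "'a geometry \<Rightarrow> ('a + 'a set) set set" where
  "apartments G = {apartment_of G d q u n | d q u n. quadrangle G d q u n}"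

definition root_of :: "'a geometry \<Rightarrow> 'a \<Rightarrow> 'a \<Rightarrow> 'a \<Rightarrow> ('a + 'a set) set" where
  "root_of G d q n = {d, q, n} <+> {join G d q, join G d n}"

(* The triple (d, q, n) spans a root of the first kind with interior {d, dq, dn}. *)
definition first_kind_root :: "'a geometry \<Rightarrow> 'a \<Rightarrow> 'a \<Rightarrow> 'a \<Rightarrow> bool" where
  "first_kind_root G d q n \<longleftrightarrow> (\<exists>u. quadrangle G d q u n)"

definition root_elation :: "'a geometry \<Rightarrow> 'a \<Rightarrow> 'a \<Rightarrow> 'a \<Rightarrow> ('a \<Rightarrow> 'a) \<Rightarrow> bool" where
  "root_elation G d q n \<theta> \<longleftrightarrow> collineation G \<theta> \<and>
     (\<forall>x \<in> join G d q \<union> join G d n. \<theta> x = x) \<and>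
     (\<forall>l\<in>lines G. d \<in> l \<longrightarrow> \<theta> ` l = l)"

definition moufang_root :: "'a geometry \<Rightarrow> 'a \<Rightarrow> 'a \<Rightarrow> 'a \<Rightarrow> bool" where
  "moufang_root G d q n \<longleftrightarrow>
     (\<forall>A\<in>apartments G. \<forall>B\<in>apartments G. root_of G d q n \<subseteq> A \<and> root_of G d q n \<subseteq> B \<longrightarrow>
        (\<exists>\<theta>. root_elation G d q n \<theta> \<and> map_sum \<theta> (image \<theta>) ` A = B))"

end

theory Submission
  imports Defs
begin

text \<open>
  Identify the residue of \<open>p\<close> with the trace \<open>p\<^sup>\<bottom> \<inter> b\<^sup>\<bottom>\<close>. A projection between residues then
  slides a point \<open>x\<close> of a trace \<open>a\<^sup>\<bottom> \<inter> c\<^sup>\<bottom>\<close> along the line \<open>cx\<close> to its point collinear to the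
  next point \<open>c'\<close>. For \<open>s\<close> on the line \<open>pd\<close>, other than \<open>p\<close> and \<open>d\<close>, and \<open>r\<close> opposite \<open>p\<close> and
  collinear to \<open>d\<close>, \<open>q\<close>, \<open>n\<close>, the projectivity \<open>p \<rightarrow> b \<rightarrow> s \<rightarrow> r \<rightarrow> p\<close> is a root elation for the root
  spanned by \<open>d\<close>, \<open>q\<close>, \<open>n\<close>: the points of \<open>dq\<close> and \<open>dn\<close> are collinear to \<open>p\<close>, \<open>b\<close>, \<open>s\<close> and \<open>r\<close>,
  and a point collinear to \<open>d\<close> stays in the plane that it spans with \<open>p\<close> and \<open>d\<close>. To move \<open>u\<close> to \<open>u'\<close>, let \<open>y\<close> be the point of \<open>bu\<close> collinear to \<open>s\<close>, let \<open>v\<close> be the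
  point of \<open>pu'\<close> collinear to \<open>y\<close>, and take for \<open>r\<close> the point of \<open>yv\<close> collinear to \<open>d\<close>.
  Finally, a root elation is determined by the image of \<open>u\<close>, so there are no others.
\<close>

section \<open>Incidence in projective planes, and apartments containing a root\<close>

lemma projective_plane_line_unique:
  assumes "projective_plane G" "x \<in> points G" "y \<in> points G" "x \<noteq> y"
    and "l \<in> lines G" "m \<in> lines G" "x \<in> l" "y \<in> l" "x \<in> m" "y \<in> m"
  shows "l = m"
proof -
  have "\<forall>x\<in>points G. \<forall>y\<in>points G. x \<noteq> y \<longrightarrow> (\<exists>!l. l \<in> lines G \<and> x \<in> l \<and> y \<in> l)"
    using assms(1) unfolding projective_plane_def by simp
  then show ?thesis using assms(2-) by metis
qed

lemma projective_plane_lines_meet: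
  assumes "projective_plane G" "l \<in> lines G" "m \<in> lines G" "l \<noteq> m"
  shows "\<exists>x. x \<in> l \<and> x \<in> m"
proof -
  have "\<forall>l\<in>lines G. \<forall>m\<in>lines G. l \<noteq> m \<longrightarrow> (\<exists>!x. x \<in> l \<and> x \<in> m)"
    using assms(1) unfolding projective_plane_def by simp
  then show ?thesis using assms(2-) by metis
qed

lemma join_commute: "join G x y = join G y x"
  unfolding join_def by (rule arg_cong[where f = The]) auto

text \<open>An apartment forgets the labelling of its vertices, so its quadrangle may be rotated
  until it starts at \<open>d\<close>. The neighbours of \<open>d\<close> are then \<open>q\<close>
  and \<open>n\<close> in some order, and a reflection corrects the order if necessary.\<close>

lemma apartment_containing_root:
  assumes "first_kind_root G d q n" "A \<in> apartments G" "root_of G d q n \<subseteq> A"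
  shows "\<exists>u. quadrangle G d q u n \<and> A = apartment_of G d q u n"
proof -
  have sym: "collin G x y \<Longrightarrow> collin G y x" for x y unfolding collin_def by blast
  have dqn: "collin G d q" "collin G d n" "\<not> collin G q n" "\<not> collin G n q"
    using assms(1) sym unfolding first_kind_root_def quadrangle_def opposite_def by blast+
  obtain d' q' u' n' where A: "A = apartment_of G d' q' u' n'" and quad: "quadrangle G d' q' u' n'"
    using assms(2) unfolding apartments_def by blast
  have rotate: "quadrangle G y z w x" "apartment_of G y z w x = apartment_of G x y z w"
    and reflect: "quadrangle G x w z y" "apartment_of G x w z y = apartment_of G x y z w"
    if "quadrangle G x y z w" for x y z w
    using that sym unfolding quadrangle_def opposite_def apartment_of_def
    by (auto simp: join_commute[of G] insert_commute)
  have mem: "d \<in> {d', q', u', n'}" "q \<in> {d', q', u', n'}" "n \<in> {d', q', u', n'}"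
    using assms(3) unfolding A root_of_def apartment_of_def by auto
  have base: "\<exists>u. quadrangle G d q u n \<and> A = apartment_of G d q u n"
    if "quadrangle G d x y z" "A = apartment_of G d x y z" "q \<in> {d, x, y, z}" "n \<in> {d, x, y, z}"
    for x y z
  proof -
    have "collin G y x" "collin G y z" "collin G d d" "\<not> collin G d y"
      using that(1) sym dqn(1) unfolding quadrangle_def opposite_def collin_def by auto
    \<comment> \<open>\<open>q\<close> and \<open>n\<close> differ from \<open>d\<close> because
      they are not collinear to each other, and from the opposite vertex \<open>y\<close> because
      they are collinear to \<open>d\<close>.\<close>
    then have "(q = x \<and> n = z) \<or> (q = z \<and> n = x)"
      using that(3,4) dqn sym by (auto simp: collin_def)
    then show ?thesis using that(1,2) reflect by blast
  qed
  show ?thesis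
    using mem(1)
  proof (elim insertE emptyE)
    assume "d = d'"
    then show ?thesis using base quad A mem by simp
  next
    assume "d = q'"
    then show ?thesis using base[of u' n' d'] rotate[OF quad] A mem by auto
  next
    assume "d = u'"
    then show ?thesis using base[of n' d' q'] rotate[OF rotate(1)[OF quad]] rotate(2)[OF quad] A mem by auto
  next
    assume "d = n'"
    then show ?thesis
      using base[of d' q' u'] rotate[OF rotate(1)[OF rotate(1)[OF quad]]]
        rotate(2)[OF rotate(1)[OF quad]] rotate(2)[OF quad] A mem by auto
  qed
qed

section \<open>Points, lines and planes of a polar space of rank 3\<close>

locale rank3_polar_space =
  fixes \<Delta> :: "'a geometry"
  assumes polar: "polar_space \<Delta>" and rank3: "polar_rank3 \<Delta>"
begin

abbreviation perp_rel :: "'a \<Rightarrow> 'a \<Rightarrow> bool" (infix "\<bottom>" 50)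
  where "x \<bottom> y \<equiv> collin \<Delta> x y"

text \<open>For opposite \<open>a\<close> and \<open>c\<close>, a point \<open>x\<close> of the
  trace stands both for the line \<open>ax\<close> of the residue of \<open>a\<close> and for the
  line \<open>cx\<close> of the residue of \<open>c\<close>.\<close>

definition trace :: "'a \<Rightarrow> 'a \<Rightarrow> 'a set"
  where "trace a c = {x. x \<bottom> a \<and> x \<bottom> c}"

text \<open>A change of coordinates in the residue of \<open>c\<close>: the line \<open>cx\<close>
  is represented by \<open>x\<close> in \<open>trace a c\<close> and by this point in
  \<open>trace c c'\<close>. The description is proper when \<open>c\<close>, \<open>c'\<close> are
  opposite and \<open>x\<close> is collinear to and distinct from \<open>c\<close>.\<close>

definition slide :: "'a \<Rightarrow> 'a \<Rightarrow> 'a \<Rightarrow> 'a"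
  where "slide c c' x = (THE y. y \<in> join \<Delta> c x \<and> y \<bottom> c')"

lemma collin_sym: "x \<bottom> y \<Longrightarrow> y \<bottom> x"
  unfolding collin_def by blast

lemma collin_refl: "x \<in> points \<Delta> \<Longrightarrow> x \<bottom> x"
  unfolding collin_def by blast

lemma collin_points: "x \<bottom> y \<Longrightarrow> x \<in> points \<Delta>" "x \<bottom> y \<Longrightarrow> y \<in> points \<Delta>"
  unfolding collin_def by blast+

lemma opposite_sym: "opposite \<Delta> x y \<Longrightarrow> opposite \<Delta> y x"
  unfolding opposite_def using collin_sym by blast

lemma opposite_not_collin: "opposite \<Delta> x y \<Longrightarrow> \<not> x \<bottom> y" "opposite \<Delta> x y \<Longrightarrow> \<not> y \<bottom> x"
  unfolding opposite_def using collin_sym by blast+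

lemma line_points: "l \<in> lines \<Delta> \<Longrightarrow> x \<in> l \<Longrightarrow> x \<in> points \<Delta>"
  using polar unfolding polar_space_def is_geometry_def by blast

lemma line_collin: "l \<in> lines \<Delta> \<Longrightarrow> x \<in> l \<Longrightarrow> y \<in> l \<Longrightarrow> x \<bottom> y"
  using line_points unfolding collin_def by blast

text \<open>The one-or-all axiom in working form: \<open>perp \<Delta> z\<close> is a
  subspace.\<close>

lemma perp_line:
  assumes "l \<in> lines \<Delta>" "x \<in> l" "y \<in> l" "x \<noteq> y" "z \<bottom> x" "z \<bottom> y" "w \<in> l"
  shows "z \<bottom> w"
proof -
  have "subspace \<Delta> (perp \<Delta> z)"
    using polar collin_points(1)[OF assms(5)] unfolding polar_space_def by blast
  then show ?thesis
    using assms unfolding subspace_def perp_def by blast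
qed

lemma line_meets_perp:
  assumes "l \<in> lines \<Delta>" "z \<in> points \<Delta>"
  obtains w where "w \<in> l" "z \<bottom> w"
  using polar assms unfolding polar_space_def perp_def by blast

lemma line_third_point:
  assumes "l \<in> lines \<Delta>"
  obtains w where "w \<in> l" "w \<noteq> x" "w \<noteq> y"
proof -
  have "at_least_three l" using assms polar unfolding polar_space_def by blast
  then show ?thesis using that unfolding at_least_three_def by metis
qed

text \<open>Zorn's lemma gives a maximal clique; it is closed under lines by one-or-all, hence a
  maximal singular subspace, hence a plane by the rank hypothesis. This is how facts about
  projective planes reach the polar space.\<close>

lemma clique_in_plane:
  assumes X: "\<And>x y. x \<in> X \<Longrightarrow> y \<in> X \<Longrightarrow> x \<bottom> y"
  shows "\<exists>M. X \<subseteq> M \<and> subspace \<Delta> M \<and> projective_plane (induced \<Delta> M)"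
proof -
  define C where "C = {S. X \<subseteq> S \<and> (\<forall>x\<in>S. \<forall>y\<in>S. x \<bottom> y)}"
  have "\<exists>M\<in>C. \<forall>S\<in>C. M \<subseteq> S \<longrightarrow> S = M"
  proof (rule subset_Zorn_nonempty)
    show "C \<noteq> {}" using X unfolding C_def by blast
    fix K assume K: "K \<noteq> {}" "subset.chain C K"
    have "x \<bottom> y" if "x \<in> \<Union>K" "y \<in> \<Union>K" for x y
    proof -
      obtain S T where ST: "S \<in> K" "x \<in> S" "T \<in> K" "y \<in> T" using \<open>x \<in> \<Union>K\<close> \<open>y \<in> \<Union>K\<close> by blast
      then have "S \<in> C" "T \<in> C" "S \<subseteq> T \<or> T \<subseteq> S"
        using K(2) unfolding subset.chain_def by blast+
      then show ?thesis using ST unfolding C_def by blast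
    qed
    moreover have "X \<subseteq> \<Union>K" using K unfolding subset.chain_def C_def by blast
    ultimately show "\<Union>K \<in> C" unfolding C_def by blast
  qed
  then obtain M where M: "M \<in> C" and max: "\<And>S. S \<in> C \<Longrightarrow> M \<subseteq> S \<Longrightarrow> S = M" by blast
  have clique: "\<forall>x\<in>M. \<forall>y\<in>M. x \<bottom> y" and XM: "X \<subseteq> M" using M unfolding C_def by blast+
  have sub: "subspace \<Delta> M"
    unfolding subspace_def
  proof (intro conjI ballI impI)
    show "M \<subseteq> points \<Delta>" using clique collin_points by blast
    fix l assume l: "l \<in> lines \<Delta>" and "\<exists>x\<in>l \<inter> M. \<exists>y\<in>l \<inter> M. x \<noteq> y"
    then obtain x y where xy: "x \<in> l" "y \<in> l" "x \<noteq> y" "x \<in> M" "y \<in> M" by blast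
    have ml: "m \<bottom> w" if "m \<in> M" "w \<in> l" for m w
      using perp_line[OF l xy(1,2,3) _ _ \<open>w \<in> l\<close>] clique xy \<open>m \<in> M\<close> by blast
    have "M \<union> l \<in> C"
      using XM clique ml collin_sym[OF ml] line_collin[OF l] unfolding C_def by blast
    then show "l \<subseteq> M" using max by blast
  qed
  have "maximal_singular_subspace \<Delta> M"
    unfolding maximal_singular_subspace_def singular_subspace_def
  proof (intro conjI allI impI sub clique)
    fix T assume T: "(subspace \<Delta> T \<and> (\<forall>x\<in>T. \<forall>y\<in>T. x \<bottom> y)) \<and> M \<subseteq> T"
    then have "T \<in> C" using XM unfolding C_def by auto
    then show "T = M" using max T by simp
  qed
  then show ?thesis using XM sub rank3 unfolding polar_rank3_def by blast
qed

text \<open>Each point of \<open>l\<close> is collinear to \<open>x\<close> and \<open>y\<close>,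
  hence to all of \<open>m\<close>. So both lines lie in one plane, where two points determine a
  line.\<close>

lemma line_unique:
  assumes l: "l \<in> lines \<Delta>" "x \<in> l" "y \<in> l" and m: "m \<in> lines \<Delta>" "x \<in> m" "y \<in> m"
    and ne: "x \<noteq> y"
  shows "l = m"
proof -
  have lm: "w \<bottom> z" if "w \<in> l" "z \<in> m" for w z
    using perp_line[OF m ne _ _ \<open>z \<in> m\<close>] line_collin[OF l(1)] l \<open>w \<in> l\<close> by blast
  have "w \<bottom> z" if "w \<in> l \<union> m" "z \<in> l \<union> m" for w z
    using lm collin_sym line_collin l(1) m(1) that by blast
  then obtain M where M: "l \<union> m \<subseteq> M" "projective_plane (induced \<Delta> M)"
    using clique_in_plane[of "l \<union> m"] by blast
  have "x \<in> points (induced \<Delta> M)" "y \<in> points (induced \<Delta> M)"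
    "l \<in> lines (induced \<Delta> M)" "m \<in> lines (induced \<Delta> M)"
    using M(1) l m unfolding induced_def by auto
  then show ?thesis using projective_plane_line_unique[OF M(2)] l(2,3) m(2,3) ne by metis
qed

lemma join_eq: "l \<in> lines \<Delta> \<Longrightarrow> x \<in> l \<Longrightarrow> y \<in> l \<Longrightarrow> x \<noteq> y \<Longrightarrow> join \<Delta> x y = l"
  unfolding join_def using line_unique by (intro the_equality) auto

lemma join_line:
  assumes "x \<bottom> y" "x \<noteq> y"
  shows "join \<Delta> x y \<in> lines \<Delta>" "x \<in> join \<Delta> x y" "y \<in> join \<Delta> x y"
proof -
  obtain l where "l \<in> lines \<Delta>" "x \<in> l" "y \<in> l" using assms unfolding collin_def by blast
  then show "join \<Delta> x y \<in> lines \<Delta>" "x \<in> join \<Delta> x y" "y \<in> join \<Delta> x y"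
    using join_eq assms by auto
qed

section \<open>Traces of opposite points and the absence of triangles\<close>

lemma trace_commute: "trace a c = trace c a"
  unfolding trace_def by blast

lemma traceD: "x \<in> trace a c \<Longrightarrow> x \<bottom> a" "x \<in> trace a c \<Longrightarrow> x \<bottom> c"
  "x \<in> trace a c \<Longrightarrow> a \<bottom> x" "x \<in> trace a c \<Longrightarrow> c \<bottom> x" "x \<in> trace a c \<Longrightarrow> x \<in> points \<Delta>"
  unfolding trace_def using collin_sym collin_points by blast+

lemma trace_neq:
  assumes "opposite \<Delta> a c" "x \<in> trace a c" shows "x \<noteq> a" "x \<noteq> c" "a \<noteq> x" "c \<noteq> x"
  using assms traceD opposite_not_collin by blast+

lemma trace_line:
  assumes "l \<in> lines \<Delta>" "x \<in> l" "y \<in> l" "x \<noteq> y" "x \<in> trace a c" "y \<in> trace a c"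
  shows "l \<subseteq> trace a c"
  using perp_line[OF assms(1-4)] traceD[OF assms(5)] traceD[OF assms(6)] collin_sym
  unfolding trace_def by blast

text \<open>Otherwise \<open>a\<close>, \<open>x\<close> and \<open>N\<close> lie in a plane, in
  which the line \<open>ax\<close> meets \<open>N\<close> in a point other than \<open>x\<close>. As
  \<open>c\<close> is collinear to that point and to \<open>x\<close>, it would be collinear to
  \<open>a\<close>.\<close>

lemma trace_no_triangle:
  assumes opp: "opposite \<Delta> a c" and N: "N \<in> lines \<Delta>" "N \<subseteq> trace a c"
    and x: "x \<in> trace a c" and yz: "y \<in> N" "z \<in> N" "y \<noteq> z" "x \<bottom> y" "x \<bottom> z"
  shows "x \<in> N"
proof (rule ccontr)
  assume xN: "x \<notin> N"
  have xw: "x \<bottom> w" if "w \<in> N" for w using perp_line N(1) yz that by blast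
  have "v \<bottom> w" if "v \<in> {a, x} \<union> N" "w \<in> {a, x} \<union> N" for v w
  proof -
    have "a \<bottom> a" using opp collin_refl unfolding opposite_def by blast
    then have au: "a \<bottom> u" and xu: "x \<bottom> u" if "u \<in> {a, x} \<union> N" for u
      using that xw traceD(1,3)[OF x] traceD(3) N(2) collin_refl[OF traceD(5)[OF x]] by auto
    have "v \<bottom> w" if "v \<in> {a, x}" using au xu \<open>w \<in> {a, x} \<union> N\<close> that by auto
    moreover have "v \<bottom> w" if "w \<in> {a, x}" "v \<in> N"
      using collin_sym[OF au] collin_sym[OF xu] that by auto
    ultimately show ?thesis
      using line_collin[OF N(1)] \<open>v \<in> {a, x} \<union> N\<close> \<open>w \<in> {a, x} \<union> N\<close> by blast
  qed
  then obtain M where M: "{a, x} \<union> N \<subseteq> M" "subspace \<Delta> M" "projective_plane (induced \<Delta> M)"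
    using clique_in_plane[of "{a, x} \<union> N"] by blast
  let ?m = "join \<Delta> a x"
  have ax: "a \<noteq> x" using trace_neq[OF opp x] by blast
  note m = join_line[OF traceD(3)[OF x] ax]
  have "?m \<subseteq> M" using M m ax unfolding subspace_def by blast
  then have "?m \<in> lines (induced \<Delta> M)" "N \<in> lines (induced \<Delta> M)"
    using M(1) N(1) m(1) unfolding induced_def by auto
  moreover have "?m \<noteq> N" using m(3) xN by blast
  ultimately have "\<exists>w. w \<in> ?m \<and> w \<in> N"
    by (rule projective_plane_lines_meet[OF M(3)])
  then obtain w where w: "w \<in> ?m" "w \<in> N" by blast
  then have "c \<bottom> a"
    using perp_line[OF m(1) w(1) m(3) _ _ _ m(2)] N(2) traceD(4)[OF x] traceD(4)[of w] xN by blast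
  then show False using opposite_not_collin opp by blast
qed

section \<open>Slides between traces, and projections between residues\<close>

lemma slide_eqI:
  assumes "c \<bottom> x" "x \<noteq> c" "\<not> c \<bottom> c'" "y \<in> join \<Delta> c x" "y \<bottom> c'"
  shows "slide c c' x = y"
  unfolding slide_def
proof (rule the_equality)
  fix z assume z: "z \<in> join \<Delta> c x \<and> z \<bottom> c'"
  note j = join_line[OF assms(1) assms(2)[symmetric]]
  show "z = y"
  proof (rule ccontr)
    assume "z \<noteq> y"
    \<comment> \<open>Two points of \<open>cx\<close> collinear to \<open>c'\<close> would make the
      whole line, \<open>c\<close> included, collinear to \<open>c'\<close>.\<close>
    then have "c' \<bottom> c"
      using perp_line[OF j(1) conjunct1[OF z] assms(4) _ collin_sym collin_sym j(2)] z assms(5) by simp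
    then show False using collin_sym assms(3) by simp
  qed
qed (use assms in auto)

lemma slide_props:
  assumes "c \<bottom> x" "x \<noteq> c" "opposite \<Delta> c c'"
  shows "slide c c' x \<in> join \<Delta> c x" "slide c c' x \<in> trace c c'"
    "join \<Delta> c (slide c c' x) = join \<Delta> c x"
proof -
  note j = join_line[OF assms(1) assms(2)[symmetric]]
  have nc: "\<not> c \<bottom> c'" "c' \<in> points \<Delta>" using assms(3) unfolding opposite_def by blast+
  obtain y where y: "y \<in> join \<Delta> c x" "y \<bottom> c'"
    using line_meets_perp[OF j(1) nc(2)] collin_sym by metis
  have eq: "slide c c' x = y" using slide_eqI assms(1,2) nc(1) y by blast
  show "slide c c' x \<in> join \<Delta> c x" "slide c c' x \<in> trace c c'"
    using eq y line_collin[OF j(1) y(1) j(2)] unfolding trace_def by blast+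
  have "c \<noteq> y" using y(2) nc(1) by blast
  then show "join \<Delta> c (slide c c' x) = join \<Delta> c x"
    using eq join_eq[OF j(1) j(2) y(1)] by simp
qed

lemma slide_fixed:
  assumes "opposite \<Delta> c c'" "x \<in> trace c c'"
  shows "slide c c' x = x"
  by (rule slide_eqI[OF traceD(3)[OF assms(2)] trace_neq(1)[OF assms] opposite_not_collin(1)[OF assms(1)]
      join_line(3)[OF traceD(3)[OF assms(2)] trace_neq(3)[OF assms]] traceD(2)[OF assms(2)]])

text \<open>One-or-all twice: \<open>y\<close> is collinear to all of \<open>cx\<close>, so the new
  point on \<open>cx\<close> is collinear to all of \<open>cy\<close>.\<close>

lemma slide_collin:
  assumes "opposite \<Delta> c c'" "c \<bottom> x" "x \<noteq> c" "c \<bottom> y" "y \<noteq> c" "x \<bottom> y"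
  shows "slide c c' x \<bottom> slide c c' y"
proof -
  note x = join_line[OF assms(2) assms(3)[symmetric]]
  note y = join_line[OF assms(4) assms(5)[symmetric]]
  note sx = slide_props[OF assms(2,3,1)]
  note sy = slide_props[OF assms(4,5,1)]
  have "y \<bottom> slide c c' x"
    using perp_line[OF x assms(3)[symmetric] _ _ sx(1)] assms collin_sym by blast
  then show ?thesis
    using perp_line[OF y assms(5)[symmetric] _ _ sy(1)] traceD[OF sx(2)] collin_sym by blast
qed

text \<open>\<open>x\<close> and its slide span the same line with \<open>c\<close>, and
  \<open>x\<close> is the point of that line collinear to \<open>a\<close>; so sliding back towards
  \<open>a\<close> recovers it.\<close>

lemma slide_trace:
  assumes "opposite \<Delta> a c" "opposite \<Delta> c c'" "x \<in> trace a c"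
  shows "slide c c' x \<in> trace c c'" "slide c a (slide c c' x) = x"
proof -
  note p = slide_props[OF traceD(4)[OF assms(3)] trace_neq(2)[OF assms(1,3)] assms(2)]
  show "slide c c' x \<in> trace c c'" by (rule p)
  show "slide c a (slide c c' x) = x"
  proof (rule slide_eqI)
    show "x \<in> join \<Delta> c (slide c c' x)"
      unfolding p(3) by (rule join_line(3)[OF traceD(4)[OF assms(3)] trace_neq(4)[OF assms(1,3)]])
  qed (use traceD(3)[OF p(2)] trace_neq(1)[OF assms(2) p(2)] traceD(1)[OF assms(3)]
      opposite_not_collin(2)[OF assms(1)] in auto)
qed

lemma slide_bij_betw:
  assumes "opposite \<Delta> a c" "opposite \<Delta> c c'"
  shows "bij_betw (slide c c') (trace a c) (trace c c')"
proof (rule bij_betw_byWitness[where f' = "slide c a"])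
  have opp: "opposite \<Delta> c' c" "opposite \<Delta> c a" using assms opposite_sym by blast+
  show "\<forall>x\<in>trace a c. slide c a (slide c c' x) = x" "slide c c' ` trace a c \<subseteq> trace c c'"
    using slide_trace[OF assms] by blast+
  show "\<forall>x\<in>trace c c'. slide c c' (slide c a x) = x" "slide c a ` trace c c' \<subseteq> trace a c"
    using slide_trace[OF opp] unfolding trace_commute[of c' c] trace_commute[of c a] by blast+
qed

lemma slide_collin_iff:
  assumes "opposite \<Delta> a c" "opposite \<Delta> c c'" "x \<in> trace a c" "y \<in> trace a c"
  shows "slide c c' x \<bottom> slide c c' y \<longleftrightarrow> x \<bottom> y"
proof
  assume "x \<bottom> y"
  then show "slide c c' x \<bottom> slide c c' y"
    by (rule slide_collin[OF assms(2) traceD(4)[OF assms(3)] trace_neq(2)[OF assms(1,3)]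
          traceD(4)[OF assms(4)] trace_neq(2)[OF assms(1,4)]])
next
  assume s: "slide c c' x \<bottom> slide c c' y"
  note x = slide_trace[OF assms(1,2,3)] and y = slide_trace[OF assms(1,2,4)]
  have "slide c a (slide c c' x) \<bottom> slide c a (slide c c' y)"
    by (rule slide_collin[OF opposite_sym[OF assms(1)] traceD(3)[OF x(1)] trace_neq(1)[OF assms(2) x(1)]
          traceD(3)[OF y(1)] trace_neq(1)[OF assms(2) y(1)] s])
  then show "x \<bottom> y" using x y by simp
qed

lemma proj_join:
  assumes "opposite \<Delta> a c" "x \<in> trace a c"
  shows "proj \<Delta> a c (join \<Delta> a x) = join \<Delta> c x"
proof -
  note j = join_line[OF traceD(3)[OF assms(2)] trace_neq(3)[OF assms]]
  \<comment> \<open>The description inside \<open>proj\<close> is the one defining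
    \<open>slide a c x\<close>.\<close>
  have "slide a c x = x" using slide_fixed assms by blast
  then have "(THE u. u \<in> join \<Delta> a x \<and> u \<bottom> c) = x" unfolding slide_def .
  then show ?thesis using j unfolding proj_def residue_def by simp
qed

text \<open>Puts the image in the coordinates \<open>trace c c'\<close>, ready for the next
  projection, from \<open>c\<close> to \<open>c'\<close>.\<close>

lemma proj_slide:
  assumes "opposite \<Delta> a c" "opposite \<Delta> c c'" "x \<in> trace a c"
  shows "proj \<Delta> a c (join \<Delta> a x) = join \<Delta> c (slide c c' x)"
  using proj_join[OF assms(1,3)]
    slide_props(3)[OF traceD(4)[OF assms(3)] trace_neq(2)[OF assms(1,3)] assms(2)] by simp

text \<open>The projectivity with base points \<open>p\<close>, \<open>b\<close>, \<open>s\<close>,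
  \<open>r\<close>, \<open>p\<close>, read on \<open>trace p b\<close>: one slide in each of the
  residues of \<open>b\<close>, \<open>s\<close>, \<open>r\<close>, \<open>p\<close>, passing
  through \<open>trace b s\<close>, \<open>trace s r\<close> and \<open>trace r p\<close>.\<close>

definition slide_cycle :: "'a \<Rightarrow> 'a \<Rightarrow> 'a \<Rightarrow> 'a \<Rightarrow> 'a \<Rightarrow> 'a"
  where "slide_cycle p b s r = slide p b \<circ> slide r p \<circ> slide s r \<circ> slide b s"

lemma slide_cycle_bij_betw:
  assumes "opposite \<Delta> p b" "opposite \<Delta> b s" "opposite \<Delta> s r" "opposite \<Delta> r p"
  shows "bij_betw (slide_cycle p b s r) (trace p b) (trace p b)"
  unfolding slide_cycle_def
  using slide_bij_betw[OF assms(1,2)] slide_bij_betw[OF assms(2,3)] slide_bij_betw[OF assms(3,4)]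
    slide_bij_betw[OF assms(4,1)]
  by (meson bij_betw_trans)

lemma slide_cycle_collin_iff:
  assumes "opposite \<Delta> p b" "opposite \<Delta> b s" "opposite \<Delta> s r" "opposite \<Delta> r p"
    and "x \<in> trace p b" "y \<in> trace p b"
  shows "slide_cycle p b s r x \<bottom> slide_cycle p b s r y \<longleftrightarrow> x \<bottom> y"
  using slide_collin_iff[OF assms(1,2)] slide_collin_iff[OF assms(2,3)]
    slide_collin_iff[OF assms(3,4)] slide_collin_iff[OF assms(4,1)]
    slide_trace(1)[OF assms(1,2)] slide_trace(1)[OF assms(2,3)] slide_trace(1)[OF assms(3,4)]
    assms(5,6)
  by (simp add: slide_cycle_def)

lemma proj_slide_cycle:
  assumes "opposite \<Delta> p b" "opposite \<Delta> b s" "opposite \<Delta> s r" "opposite \<Delta> r p"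
    and "x \<in> trace p b"
  shows "join \<Delta> p (slide_cycle p b s r x) =
    (proj \<Delta> r p \<circ> proj \<Delta> s r \<circ> proj \<Delta> b s \<circ> proj \<Delta> p b) (join \<Delta> p x)"
  using proj_slide[OF assms(1,2)] proj_slide[OF assms(2,3)] proj_slide[OF assms(3,4)]
    proj_slide[OF assms(4,1)]
    slide_trace(1)[OF assms(1,2)] slide_trace(1)[OF assms(2,3)] slide_trace(1)[OF assms(3,4)]
    assms(5)
  by (simp add: slide_cycle_def)

end

section \<open>The quadrangle of two opposite points and its collineations\<close>

locale opposite_points = rank3_polar_space +
  fixes p b :: 'a
  assumes opp: "opposite \<Delta> p b"
begin

abbreviation \<Gamma> :: "'a geometry"
  where "\<Gamma> \<equiv> perp_quadrangle \<Delta> p b"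

lemma points_quadrangle: "points \<Gamma> = trace p b"
  unfolding perp_quadrangle_def induced_def trace_def perp_def using collin_sym by auto

lemma lines_quadrangle: "lines \<Gamma> = {l \<in> lines \<Delta>. l \<subseteq> trace p b}"
  using points_quadrangle unfolding perp_quadrangle_def induced_def by simp

lemma quadrangle_lineD: "l \<in> lines \<Gamma> \<Longrightarrow> l \<in> lines \<Delta>" "l \<in> lines \<Gamma> \<Longrightarrow> x \<in> l \<Longrightarrow> x \<in> trace p b"
  using lines_quadrangle by auto

text \<open>A line of \<open>\<Delta>\<close> with two points in the trace lies inside it, so joins
  can be computed in \<open>\<Delta>\<close> throughout.\<close>

lemma join_in_quadrangle:
  assumes "x \<in> trace p b" "y \<in> trace p b" "x \<bottom> y" "x \<noteq> y"
  shows "join \<Delta> x y \<in> lines \<Gamma>" "join \<Gamma> x y = join \<Delta> x y"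
proof -
  note j = join_line[OF assms(3,4)]
  show *: "join \<Delta> x y \<in> lines \<Gamma>"
    using trace_line[OF j assms(4,1,2)] j(1) by (simp add: lines_quadrangle)
  show "join \<Gamma> x y = join \<Delta> x y"
    unfolding join_def[of \<Gamma>]
    using * j(2,3) join_eq assms(4) by (intro the_equality) (auto dest: quadrangle_lineD(1))
qed

lemma collin_quadrangle: "collin \<Gamma> x y \<longleftrightarrow> x \<in> trace p b \<and> y \<in> trace p b \<and> x \<bottom> y"
proof
  assume "collin \<Gamma> x y"
  then show "x \<in> trace p b \<and> y \<in> trace p b \<and> x \<bottom> y"
    unfolding collin_def[of \<Gamma>] points_quadrangle
    using line_collin quadrangle_lineD(1) collin_refl traceD(5) by metis
next
  assume *: "x \<in> trace p b \<and> y \<in> trace p b \<and> x \<bottom> y"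
  then have "x \<noteq> y \<Longrightarrow> join \<Delta> x y \<in> lines \<Gamma> \<and> x \<in> join \<Delta> x y \<and> y \<in> join \<Delta> x y"
    using join_in_quadrangle(1) join_line by simp
  then show "collin \<Gamma> x y"
    using * unfolding collin_def[of \<Gamma>] points_quadrangle by metis
qed

lemma quadrangle_iff:
  "quadrangle \<Gamma> d q u n \<longleftrightarrow> {d, q, u, n} \<subseteq> trace p b \<and>
     d \<bottom> q \<and> q \<bottom> u \<and> u \<bottom> n \<and> n \<bottom> d \<and> \<not> d \<bottom> u \<and> \<not> q \<bottom> n"
  unfolding quadrangle_def opposite_def collin_quadrangle points_quadrangle by auto

lemma quadrangle_no_triangle:
  assumes "N \<in> lines \<Gamma>" "x \<in> trace p b" "y \<in> N" "z \<in> N" "y \<noteq> z" "x \<bottom> y" "x \<bottom> z"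
  shows "x \<in> N"
  using trace_no_triangle[OF opp _ _ assms(2-7)] assms(1) by (simp add: lines_quadrangle)

lemma quadrangle_line_unique:
  assumes "l \<in> lines \<Gamma>" "m \<in> lines \<Gamma>" "x \<in> l" "y \<in> l" "x \<in> m" "y \<in> m" "x \<noteq> y"
  shows "l = m"
  using line_unique assms quadrangle_lineD(1) by metis

lemma quadrangle_perp_point:
  assumes "l \<in> lines \<Gamma>" "x \<in> trace p b"
  obtains y where "y \<in> l" "x \<bottom> y" "y \<in> trace p b"
  using line_meets_perp[OF quadrangle_lineD(1)[OF assms(1)] traceD(5)[OF assms(2)]]
    quadrangle_lineD(2)[OF assms(1)] by metis

text \<open>As there are no triangles, a line of the quadrangle consists of the points of the trace
  collinear to two distinct points of it. Collinearity alone thus determines the lines.\<close>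

lemma image_line_of_collin_iff:
  assumes bij: "bij_betw f (trace p b) (trace p b)"
    and iff: "\<And>x y. x \<in> trace p b \<Longrightarrow> y \<in> trace p b \<Longrightarrow> f x \<bottom> f y \<longleftrightarrow> x \<bottom> y"
    and l: "l \<in> lines \<Gamma>"
  shows "f ` l \<in> lines \<Gamma>"
proof -
  have ftr: "f z \<in> trace p b" if "z \<in> trace p b" for z
    using bij that unfolding bij_betw_def by blast
  obtain x where x: "x \<in> l" using line_third_point[OF quadrangle_lineD(1)[OF l]] .
  obtain y where y: "y \<in> l" "y \<noteq> x" using line_third_point[OF quadrangle_lineD(1)[OF l]] .
  note tr = quadrangle_lineD(2)[OF l]
  have xy: "x \<bottom> y" using line_collin quadrangle_lineD(1) l x y by blast
  have ne: "f x \<noteq> f y" using bij x y tr unfolding bij_betw_def inj_on_def by blast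
  have coll: "f x \<bottom> f y" using iff tr x y xy by blast
  note m = join_in_quadrangle(1)[OF ftr[OF tr[OF x]] ftr[OF tr[OF y(1)]] coll ne]
  note j = join_line[OF coll ne]
  have "f ` l = join \<Delta> (f x) (f y)"
  proof (intro equalityI subsetI)
    fix z assume "z \<in> f ` l"
    then obtain w where w: "w \<in> l" "z = f w" by blast
    have "w \<bottom> x" "w \<bottom> y" using line_collin[OF quadrangle_lineD(1)[OF l]] w x y by blast+
    then have "z \<bottom> f x" "z \<bottom> f y" using iff tr w x y by simp_all
    then show "z \<in> join \<Delta> (f x) (f y)"
      using quadrangle_no_triangle[OF m _ j(2,3) ne] ftr tr w by simp
  next
    fix z assume z: "z \<in> join \<Delta> (f x) (f y)"
    then have "z \<in> trace p b" using quadrangle_lineD(2)[OF m] by blast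
    then obtain w where w: "w \<in> trace p b" "z = f w" using bij unfolding bij_betw_def by blast
    have "z \<bottom> f x" "z \<bottom> f y" using line_collin[OF j(1)] z j by blast+
    then have "w \<bottom> x" "w \<bottom> y" using iff tr w x y by simp_all
    then have "w \<in> l" using quadrangle_no_triangle[OF l w(1) x y(1)] y by simp
    then show "z \<in> f ` l" using w by blast
  qed
  then show ?thesis using m by simp
qed

lemma collineation_of_collin_iff:
  assumes bij: "bij_betw f (trace p b) (trace p b)"
    and iff: "\<And>x y. x \<in> trace p b \<Longrightarrow> y \<in> trace p b \<Longrightarrow> f x \<bottom> f y \<longleftrightarrow> x \<bottom> y"
  shows "collineation \<Gamma> f"
proof -
  define g where "g = the_inv_into (trace p b) f"
  have gbij: "bij_betw g (trace p b) (trace p b)"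
    unfolding g_def using bij by (rule bij_betw_the_inv_into)
  have fg: "f (g x) = x" "g x \<in> trace p b" if "x \<in> trace p b" for x
    using f_the_inv_into_f_bij_betw[OF bij] bij_betw_apply[OF gbij] that unfolding g_def by auto
  \<comment> \<open>The inverse satisfies the same hypothesis, so it supplies the preimage of a
    line.\<close>
  have giff: "g x \<bottom> g y \<longleftrightarrow> x \<bottom> y" if "x \<in> trace p b" "y \<in> trace p b" for x y
    using iff[OF fg(2) fg(2)] fg(1) that by metis
  have "inj_on (image f) (lines \<Gamma>)"
    using inj_on_image_Pow[of f "trace p b"] bij lines_quadrangle
    unfolding bij_betw_def by (auto intro: inj_on_subset)
  moreover have "l \<in> image f ` lines \<Gamma>" if "l \<in> lines \<Gamma>" for l
  proof -
    have "f ` (g ` l) = l" using fg(1) quadrangle_lineD(2)[OF that] by force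
    then show ?thesis using image_line_of_collin_iff[OF gbij giff that] by blast
  qed
  moreover have "f ` l \<in> lines \<Gamma>" if "l \<in> lines \<Gamma>" for l
    using image_line_of_collin_iff[OF bij iff that] by blast
  ultimately have "bij_betw (image f) (lines \<Gamma>) (lines \<Gamma>)"
    unfolding bij_betw_def by blast
  then show ?thesis using bij unfolding collineation_def points_quadrangle by blast
qed

lemma collineation_trace: "collineation \<Gamma> f \<Longrightarrow> x \<in> trace p b \<Longrightarrow> f x \<in> trace p b"
  unfolding collineation_def points_quadrangle bij_betw_def by blast

lemma collineation_line: "collineation \<Gamma> f \<Longrightarrow> l \<in> lines \<Gamma> \<Longrightarrow> f ` l \<in> lines \<Gamma>"
  unfolding collineation_def bij_betw_def by blast

lemma collineation_inj:
  "collineation \<Gamma> f \<Longrightarrow> x \<in> trace p b \<Longrightarrow> y \<in> trace p b \<Longrightarrow> f x = f y \<Longrightarrow> x = y"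
  unfolding collineation_def points_quadrangle bij_betw_def by (auto dest: inj_onD)

lemma collineation_collin:
  assumes "collineation \<Gamma> f" "x \<in> trace p b" "y \<in> trace p b" "x \<bottom> y"
  shows "f x \<bottom> f y"
proof (cases "x = y")
  case True
  then show ?thesis using collineation_trace[OF assms(1,2)] collin_refl traceD(5) by simp
next
  case False
  note l = join_in_quadrangle(1)[OF assms(2-4) False]
  show ?thesis
    using line_collin[OF quadrangle_lineD(1)[OF collineation_line[OF assms(1) l]]]
      join_line(2,3)[OF assms(4) False] by blast
qed

lemma collineation_join:
  assumes "collineation \<Gamma> f" "x \<in> trace p b" "y \<in> trace p b" "x \<bottom> y" "x \<noteq> y"
  shows "f ` join \<Gamma> x y = join \<Gamma> (f x) (f y)"
proof -
  have ne: "f x \<noteq> f y" using collineation_inj assms by blast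
  have tr: "f x \<in> trace p b" "f y \<in> trace p b" using collineation_trace assms by blast+
  have c: "f x \<bottom> f y" using collineation_collin assms by blast
  have l: "f ` join \<Delta> x y \<in> lines \<Gamma>"
    using collineation_line[OF assms(1) join_in_quadrangle(1)[OF assms(2-5)]] .
  have "f ` join \<Delta> x y = join \<Delta> (f x) (f y)"
    using quadrangle_line_unique[OF l join_in_quadrangle(1)[OF tr c ne] _ _ _ _ ne]
      join_line(2,3)[OF assms(4,5)] join_line(2,3)[OF c ne] by blast
  then show ?thesis
    using join_in_quadrangle(2)[OF tr c ne] join_in_quadrangle(2)[OF assms(2-5)] by simp
qed

end

section \<open>Rigidity of root elations\<close>

locale agreeing_root_elations = opposite_points +
  fixes d q u n :: 'a and f g :: "'a \<Rightarrow> 'a"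
  assumes quad: "quadrangle \<Gamma> d q u n"
    and elation: "root_elation \<Gamma> d q n f" "root_elation \<Gamma> d q n g"
    and agree_u: "f u = g u"
begin

lemma collineations: "collineation \<Gamma> f" "collineation \<Gamma> g"
  using elation unfolding root_elation_def by blast+

lemma quad_trace: "d \<in> trace p b" "q \<in> trace p b" "u \<in> trace p b" "n \<in> trace p b"
  and quad_collin: "d \<bottom> q" "q \<bottom> u" "u \<bottom> n" "n \<bottom> d" "\<not> d \<bottom> u" "\<not> q \<bottom> n"
  using quad unfolding quadrangle_iff by blast+

lemma quad_neq: "d \<noteq> q" "d \<noteq> n" "q \<noteq> u" "u \<noteq> n" "q \<noteq> n"
  using quad_collin quad_trace collin_refl traceD(5) collin_sym by blast+

text \<open>The hypotheses are symmetric in \<open>q\<close> and \<open>n\<close>; this halves the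
  case analysis in \<open>agree\<close>.\<close>

lemma swap: "agreeing_root_elations \<Delta> p b d n u q f g"
proof unfold_locales
  show "quadrangle \<Gamma> d n u q" using quad collin_sym unfolding quadrangle_iff by blast
  show "root_elation \<Gamma> d n q f" "root_elation \<Gamma> d n q g"
    using elation unfolding root_elation_def by (simp_all add: Un_commute)
qed (rule agree_u)

lemma agree_on_sides: "x \<in> join \<Delta> d q \<Longrightarrow> f x = g x" "x \<in> join \<Delta> d n \<Longrightarrow> f x = g x"
proof -
  have "join \<Gamma> d q = join \<Delta> d q" "join \<Gamma> d n = join \<Delta> d n"
    using join_in_quadrangle(2) quad_trace quad_collin quad_neq collin_sym by auto
  then show "x \<in> join \<Delta> d q \<Longrightarrow> f x = g x" "x \<in> join \<Delta> d n \<Longrightarrow> f x = g x"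
    using elation unfolding root_elation_def by auto
qed

lemma agree_center_line: "l \<in> lines \<Gamma> \<Longrightarrow> d \<in> l \<Longrightarrow> f ` l = g ` l"
  using elation unfolding root_elation_def by auto

lemma agree_join:
  assumes "x \<in> trace p b" "y \<in> trace p b" "x \<bottom> y" "x \<noteq> y" "f x = g x" "f y = g y"
  shows "f ` join \<Delta> x y = g ` join \<Delta> x y"
  using collineation_join[OF collineations(1) assms(1-4)]
    collineation_join[OF collineations(2) assms(1-4)] join_in_quadrangle(2)[OF assms(1-4)] assms(5,6)
  by simp

text \<open>Without triangles, \<open>x\<close> is the only point of \<open>N\<close> collinear to
  \<open>l\<close>, so its image is the only point of the common image of \<open>N\<close> collinear
  to the common image of \<open>l\<close>. All further agreement spreads this way.\<close>

lemma agree_by_projection: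
  assumes N: "N \<in> lines \<Gamma>" "f ` N = g ` N" "x \<in> N"
    and l: "l \<in> trace p b" "f l = g l" "l \<bottom> x" "l \<notin> N"
  shows "f x = g x"
proof (rule ccontr)
  assume ne: "f x \<noteq> g x"
  note fN = collineation_line[OF collineations(1) N(1)]
  have x: "x \<in> trace p b" using quadrangle_lineD(2) N by blast
  have mem: "f x \<in> f ` N" "g x \<in> f ` N" using N by auto
  have "f l \<bottom> f x" using collineation_collin[OF collineations(1) l(1) x l(3)] .
  moreover have "f l \<bottom> g x" using collineation_collin[OF collineations(2) l(1) x l(3)] l(2) by simp
  ultimately have "f l \<in> f ` N"
    using quadrangle_no_triangle[OF fN collineation_trace[OF collineations(1) l(1)] mem ne] by blast
  then obtain w where w: "w \<in> N" "f l = f w" by blast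
  then show False
    using collineation_inj[OF collineations(1) l(1) quadrangle_lineD(2)[OF N(1) w(1)]] l(4) by blast
qed

text \<open>Points of \<open>qu\<close> other than \<open>q\<close> are projections of points of
  \<open>dn\<close>, which both maps fix.\<close>

lemma agree_on_qu:
  assumes "y \<in> join \<Delta> q u" shows "f y = g y"
proof (cases "y = q")
  case True
  then show ?thesis using agree_on_sides(1) join_line(3) quad_collin quad_neq by blast
next
  case False
  have dn: "d \<bottom> n" using quad_collin collin_sym by blast
  note B = join_in_quadrangle(1)[OF quad_trace(1,4) dn quad_neq(2)] join_line[OF dn quad_neq(2)]
  note C = join_in_quadrangle(1)[OF quad_trace(2,3) quad_collin(2) quad_neq(3)]
    join_line[OF quad_collin(2) quad_neq(3)]
  have fq: "f q = g q" using agree_on_sides(1) join_line(3) quad_collin quad_neq by blast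
  have y: "y \<in> trace p b" using quadrangle_lineD(2)[OF C(1) assms] .
  obtain r where r: "r \<in> join \<Delta> d n" "y \<bottom> r" "r \<in> trace p b"
    using quadrangle_perp_point[OF B(1) y] .
  \<comment> \<open>\<open>d\<close> is the only point of \<open>dn\<close> collinear to
    \<open>q\<close>, and \<open>d\<close> is not collinear to \<open>u\<close>.\<close>
  have "r \<notin> join \<Delta> q u"
  proof
    assume rC: "r \<in> join \<Delta> q u"
    have qr: "q \<bottom> r" using line_collin[OF C(2,3) rC] .
    have "r = d"
    proof (rule ccontr)
      assume "r \<noteq> d"
      then show False
        using perp_line[OF B(2) r(1) B(3) _ qr _ B(4)] quad_collin collin_sym by blast
    qed
    then show False using line_collin[OF C(2) rC C(4)] quad_collin by blast
  qed
  then show ?thesis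
    using agree_by_projection[OF C(1) agree_join[OF quad_trace(2,3) quad_collin(2) quad_neq(3) fq agree_u]
        assms r(3) agree_on_sides(2)[OF r(1)] collin_sym[OF r(2)]] by blast
qed

text \<open>Both maps stabilize the line \<open>dx\<close>, and \<open>x\<close> is the projection
  onto it of a point of \<open>qu\<close>; that point is off \<open>dx\<close> unless
  \<open>dx\<close> is \<open>dq\<close>.\<close>

lemma agree_on_perp:
  assumes x: "x \<in> trace p b" "d \<bottom> x"
  shows "f x = g x"
proof (cases "x \<in> join \<Delta> d q")
  case True
  then show ?thesis by (rule agree_on_sides)
next
  case False
  note A = join_line[OF quad_collin(1) quad_neq(1)]
  have ne: "d \<noteq> x" using False A(2) by blast
  note L = join_in_quadrangle(1)[OF quad_trace(1) x ne] join_line[OF x(2) ne]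
  note C = join_in_quadrangle(1)[OF quad_trace(2,3) quad_collin(2) quad_neq(3)]
    join_line[OF quad_collin(2) quad_neq(3)]
  obtain y where y: "y \<in> join \<Delta> q u" "x \<bottom> y" "y \<in> trace p b"
    using quadrangle_perp_point[OF C(1) x(1)] .
  have "y \<notin> join \<Delta> d x"
  proof
    assume yL: "y \<in> join \<Delta> d x"
    have dy: "d \<bottom> y" using line_collin[OF L(2,3) yL] .
    have "y = q"
      using perp_line[OF C(2) y(1) C(3) _ dy quad_collin(1) C(4)] quad_collin(5) by blast
    then have "join \<Delta> d x = join \<Delta> d q"
      using line_unique[OF L(2,3) _ A(1,2,3) quad_neq(1)] yL by blast
    then show False using False L(4) by simp
  qed
  then show ?thesis
    using agree_by_projection[OF L(1) agree_center_line[OF L(1,3)] L(4) y(3) agree_on_qu[OF y(1)]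
        collin_sym[OF y(2)]] by blast
qed

text \<open>The points of \<open>dq\<close> and \<open>dn\<close> collinear to \<open>x\<close> are
  fixed, and either one off \<open>N\<close> settles \<open>x\<close>. If both were on
  \<open>N\<close>, they would coincide, since \<open>d\<close> is off \<open>N\<close> and there
  are no triangles; then \<open>dq\<close> would equal \<open>dn\<close>.\<close>

lemma agree_on_line:
  assumes N: "N \<in> lines \<Gamma>" "d \<notin> N" "f ` N = g ` N" and x: "x \<in> N"
  shows "f x = g x"
proof (rule ccontr)
  assume ne: "f x \<noteq> g x"
  have dn: "d \<bottom> n" using quad_collin collin_sym by blast
  note A = join_in_quadrangle(1)[OF quad_trace(1,2) quad_collin(1) quad_neq(1)]
    join_line[OF quad_collin(1) quad_neq(1)]
  note B = join_in_quadrangle(1)[OF quad_trace(1,4) dn quad_neq(2)] join_line[OF dn quad_neq(2)]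
  have xt: "x \<in> trace p b" using quadrangle_lineD(2)[OF N(1) x] .
  obtain r where r: "r \<in> join \<Delta> d q" "x \<bottom> r" "r \<in> trace p b"
    using quadrangle_perp_point[OF A(1) xt] .
  obtain s where s: "s \<in> join \<Delta> d n" "x \<bottom> s" "s \<in> trace p b"
    using quadrangle_perp_point[OF B(1) xt] .
  have rN: "r \<in> N"
    using agree_by_projection[OF N(1,3) x r(3) agree_on_sides(1)[OF r(1)] collin_sym[OF r(2)]] ne by blast
  have sN: "s \<in> N"
    using agree_by_projection[OF N(1,3) x s(3) agree_on_sides(2)[OF s(1)] collin_sym[OF s(2)]] ne by blast
  have "d \<bottom> r" "d \<bottom> s" using line_collin[OF A(2,3) r(1)] line_collin[OF B(2,3) s(1)] .
  then have "r = s" using quadrangle_no_triangle[OF N(1) quad_trace(1) rN sN] N(2) by blast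
  moreover have "r \<noteq> d" using rN N(2) by blast
  ultimately have "join \<Delta> d q = join \<Delta> d n"
    using line_unique[OF A(2) r(1) A(3) B(2) _ B(3)] s(1) by blast
  then show False using line_collin[OF A(2,4)] B(4) quad_collin(6) by simp
qed

text \<open>Off \<open>qu\<close>, join \<open>x\<close> to the point \<open>y\<close> of
  \<open>qu\<close> collinear to it. The line \<open>xy\<close> has a point \<open>a\<close>
  collinear to \<open>d\<close>, and agreement at \<open>a\<close> and \<open>y\<close> gives a
  common image of the line. As \<open>x\<close> is not collinear to \<open>q\<close>,
  \<open>y\<close> is not \<open>q\<close>, so \<open>a\<close> and \<open>y\<close> differ.\<close>

lemma agree_off_q_perp:
  assumes x: "x \<in> trace p b" "\<not> d \<bottom> x" "\<not> q \<bottom> x"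
  shows "f x = g x"
proof -
  note C = join_in_quadrangle(1)[OF quad_trace(2,3) quad_collin(2) quad_neq(3)]
    join_line[OF quad_collin(2) quad_neq(3)]
  obtain y where y: "y \<in> join \<Delta> q u" "x \<bottom> y" "y \<in> trace p b"
    using quadrangle_perp_point[OF C(1) x(1)] .
  show ?thesis
  proof (cases "x = y")
    case True
    then show ?thesis using agree_on_qu y(1) by simp
  next
    case False
    note N = join_in_quadrangle(1)[OF x(1) y(3,2) False] join_line[OF y(2) False]
    have dN: "d \<notin> join \<Delta> x y" using line_collin[OF N(2) _ N(3)] x(2) by blast
    obtain a where a: "a \<in> join \<Delta> x y" "d \<bottom> a" "a \<in> trace p b"
      using quadrangle_perp_point[OF N(1) quad_trace(1)] .
    have "y \<noteq> q" using y(2) x(3) collin_sym by blast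
    then have "\<not> d \<bottom> y"
      using perp_line[OF C(2) y(1) C(3) _ _ quad_collin(1) C(4)] quad_collin(5) by blast
    then have ay: "a \<noteq> y" using a(2) by blast
    have "join \<Delta> a y = join \<Delta> x y" using join_eq[OF N(2) a(1) N(4) ay] .
    then have "f ` join \<Delta> x y = g ` join \<Delta> x y"
      using agree_join[OF a(3) y(3) line_collin[OF N(2) a(1) N(4)] ay
          agree_on_perp[OF a(3,2)] agree_on_qu[OF y(1)]] by simp
    then show ?thesis using agree_on_line[OF N(1) dN _ N(3)] by blast
  qed
qed

theorem agree:
  assumes x: "x \<in> trace p b" shows "f x = g x"
proof -
  interpret sw: agreeing_root_elations \<Delta> p b d n u q f g by (rule swap)
  consider "d \<bottom> x" | "\<not> d \<bottom> x" "\<not> q \<bottom> x" | "\<not> d \<bottom> x" "\<not> n \<bottom> x"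
    | "\<not> d \<bottom> x" "q \<bottom> x" "n \<bottom> x" by blast
  then show ?thesis
  proof cases
    \<comment> \<open>Neither version of \<open>agree_off_q_perp\<close> applies to
      \<open>x\<close>, but a third point \<open>w\<close> of \<open>qx\<close> is collinear to
      neither \<open>d\<close> nor \<open>n\<close>. The swapped version settles \<open>w\<close>,
      and \<open>q\<close> and \<open>w\<close> determine the image of the line.\<close>
    case 4
    have ne: "q \<noteq> x" using 4 quad_collin collin_sym by blast
    note N = join_in_quadrangle(1)[OF quad_trace(2) x 4(2) ne] join_line[OF 4(2) ne]
    obtain w where w: "w \<in> join \<Delta> q x" "w \<noteq> q" "w \<noteq> x" using line_third_point[OF N(2)] .
    have wt: "w \<in> trace p b" using quadrangle_lineD(2)[OF N(1) w(1)] .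
    have dw: "\<not> d \<bottom> w"
      using perp_line[OF N(2) w(1) N(3) w(2) _ quad_collin(1) N(4)] 4(1) by blast
    have "\<not> n \<bottom> w"
      using perp_line[OF N(2) w(1) N(4) w(3) _ 4(3) N(3)] quad_collin(6) collin_sym by blast
    then have fw: "f w = g w" using sw.agree_off_q_perp wt dw by blast
    have fq: "f q = g q" by (rule agree_on_perp[OF quad_trace(2) quad_collin(1)])
    have "join \<Delta> q w = join \<Delta> q x" using join_eq[OF N(2,3) w(1)] w(2) by blast
    then have "f ` join \<Delta> q x = g ` join \<Delta> q x"
      using agree_join[OF quad_trace(2) wt line_collin[OF N(2,3) w(1)] w(2)[symmetric] fq fw] by simp
    moreover have "d \<notin> join \<Delta> q x" using line_collin[OF N(2) _ N(4)] 4(1) by blast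
    ultimately show ?thesis using agree_on_line[OF N(1) _ _ N(4)] by blast
  qed (use agree_on_perp agree_off_q_perp sw.agree_off_q_perp x in blast)+
qed

end

section \<open>Slide cycles as root elations, transitivity and the Moufang property\<close>

context opposite_points
begin

lemma slide_cycle_root_elation:
  assumes quad: "quadrangle \<Gamma> d q u n"
    and s: "s \<in> join \<Delta> p d" "s \<noteq> p" "s \<noteq> d"
    and r: "r \<bottom> d" "r \<bottom> q" "r \<bottom> n" "opposite \<Delta> r p"
  shows "opposite \<Delta> b s" "opposite \<Delta> s r" "root_elation \<Gamma> d q n (slide_cycle p b s r)"
proof -
  have dqn: "d \<in> trace p b" "q \<in> trace p b" "n \<in> trace p b"
    and dq: "d \<bottom> q" and dn: "d \<bottom> n" and qn: "\<not> q \<bottom> n"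
    using quad collin_sym unfolding quadrangle_iff by auto
  have ne: "d \<noteq> q" "d \<noteq> n" using dq dn qn collin_sym by blast+
  have pd: "p \<noteq> d" "p \<bottom> d" using trace_neq(3)[OF opp dqn(1)] traceD(3)[OF dqn(1)] by blast+
  note L = join_line[OF pd(2,1)]
  have sd: "s \<bottom> d" "s \<bottom> p" using line_collin[OF L(1) s(1)] L(2,3) by blast+
  \<comment> \<open>On the line \<open>pd\<close>, collinearity to two of \<open>p\<close>,
    \<open>d\<close>, \<open>s\<close> forces collinearity to the third.\<close>
  have perp_s: "z \<bottom> s" if "z \<bottom> p" "z \<bottom> d" for z
    using perp_line[OF L pd(1) that s(1)] .
  have perp_p: "z \<bottom> p" if "z \<bottom> s" "z \<bottom> d" for z
    using perp_line[OF L(1) s(1) L(3) s(3) that L(2)] .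
  have s_point: "s \<in> points \<Delta>" using line_points[OF L(1) s(1)] .
  have "\<not> b \<bottom> s" using perp_p traceD(4)[OF dqn(1)] opposite_not_collin(2)[OF opp] by blast
  then show bs: "opposite \<Delta> b s" using opp s_point unfolding opposite_def by blast
  have "\<not> r \<bottom> s" using perp_p r(1) opposite_not_collin(1)[OF r(4)] by blast
  then show sr: "opposite \<Delta> s r"
    using r(4) s_point collin_sym unfolding opposite_def by blast
  note rp = r(4)
  let ?\<theta> = "slide_cycle p b s r"
  note bij = slide_cycle_bij_betw[OF opp bs sr rp]
  have coll: "collineation \<Gamma> ?\<theta>"
    using collineation_of_collin_iff[OF bij] slide_cycle_collin_iff[OF opp bs sr rp] by blast
  \<comment> \<open>Such a point lies in all four traces, so no slide moves it.\<close>
  have fixed: "?\<theta> x = x" if x: "x \<in> trace p b" "x \<bottom> d" "x \<bottom> r" for x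
  proof -
    have xs: "x \<bottom> s" using perp_s traceD(1)[OF x(1)] x(2) by blast
    have "x \<in> trace b s" "x \<in> trace s r" "x \<in> trace r p" "x \<in> trace p b"
      using x xs traceD[OF x(1)] unfolding trace_def by blast+
    then show ?thesis using slide_fixed opp bs sr rp by (simp add: slide_cycle_def)
  qed
  have fixed_side: "?\<theta> x = x"
    if e: "e \<in> trace p b" "d \<bottom> e" "d \<noteq> e" "r \<bottom> e" and x: "x \<in> join \<Delta> d e" for e x
  proof -
    note E = join_line[OF e(2,3)]
    have "x \<bottom> d" using line_collin[OF E(1) x E(2)] .
    moreover have "x \<bottom> r" using perp_line[OF E e(3) r(1) e(4) x] collin_sym by blast
    moreover have "x \<in> trace p b"
      using quadrangle_lineD(2)[OF join_in_quadrangle(1)[OF dqn(1) e(1-3)] x] .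
    ultimately show ?thesis using fixed by blast
  qed
  \<comment> \<open>Only the slides at \<open>s\<close> and \<open>p\<close> can move points here:
    \<open>x\<close> is collinear to \<open>s\<close>, and its slide \<open>?y\<close> along
    \<open>sx\<close> is still collinear to \<open>p\<close>. The last slide runs along the line
    through \<open>p\<close> and \<open>?y\<close>, all of whose points are collinear to
    \<open>x\<close>.\<close>
  have perp_image: "x \<bottom> ?\<theta> x" if x: "x \<in> trace p b" "x \<bottom> d" for x
  proof -
    have xs: "x \<bottom> s" using perp_s traceD(1)[OF x(1)] x(2) by blast
    have xbs: "x \<in> trace b s" using xs traceD[OF x(1)] unfolding trace_def by blast
    have x1: "slide b s x = x" using slide_fixed[OF bs xbs] .
    have sx: "s \<bottom> x" "x \<noteq> s" using collin_sym xs trace_neq(2)[OF bs xbs] by blast+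
    note S = join_line[OF sx(1) sx(2)[symmetric]]
    note y = slide_props[OF sx sr]
    let ?y = "slide s r x"
    have xp: "p \<bottom> x" using traceD[OF x(1)] by blast
    have "p \<bottom> ?y"
      using perp_line[OF S sx(2)[symmetric] _ xp y(1)] sd(2) collin_sym by blast
    then have yrp: "?y \<in> trace r p"
      using y(2) collin_sym unfolding trace_def by blast
    have x3: "slide r p ?y = ?y" using slide_fixed[OF rp yrp] .
    have py: "p \<bottom> ?y" "?y \<noteq> p" using traceD(4)[OF yrp] trace_neq(2)[OF rp yrp] .
    note P = join_line[OF py(1) py(2)[symmetric]]
    have "x \<bottom> ?y" using line_collin[OF S(1,3) y(1)] .
    then have "x \<bottom> slide p b ?y"
      using perp_line[OF P py(2)[symmetric] collin_sym[OF xp] _ slide_props(1)[OF py opp]] by blast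
    then show ?thesis using x1 x3 by (simp add: slide_cycle_def)
  qed
  have d_fixed: "?\<theta> d = d" using fixed[OF dqn(1)] collin_refl traceD(5)[OF dqn(1)] collin_sym r(1) by blast
  \<comment> \<open>The image of a further point of \<open>l\<close> is collinear to that point and
    to \<open>d\<close>, so it is on \<open>l\<close> by the absence of triangles; two common points
    identify the lines.\<close>
  have stable: "?\<theta> ` l = l" if l: "l \<in> lines \<Gamma>" "d \<in> l" for l
  proof -
    obtain x where x: "x \<in> l" "x \<noteq> d" using line_third_point[OF quadrangle_lineD(1)[OF l(1)]] .
    have xt: "x \<in> trace p b" using quadrangle_lineD(2)[OF l(1) x(1)] .
    have xd: "x \<bottom> d" using line_collin[OF quadrangle_lineD(1)[OF l(1)] x(1) l(2)] .
    have "?\<theta> x \<bottom> d"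
      using collineation_collin[OF coll xt dqn(1) xd] d_fixed by simp
    then have "?\<theta> x \<in> l"
      using quadrangle_no_triangle[OF l(1) collineation_trace[OF coll xt] x(1) l(2) x(2)]
        perp_image[OF xt xd] collin_sym by blast
    moreover have "?\<theta> x \<noteq> d" using collineation_inj[OF coll xt dqn(1)] d_fixed x(2) by auto
    moreover have "d \<in> ?\<theta> ` l" using d_fixed l(2) by (metis imageI)
    ultimately show ?thesis
      using quadrangle_line_unique[OF collineation_line[OF coll l(1)] l(1) imageI[OF x(1)] _ _ l(2)]
      by blast
  qed
  have sides: "join \<Gamma> d q = join \<Delta> d q" "join \<Gamma> d n = join \<Delta> d n"
    using join_in_quadrangle(2) dqn dq dn ne by auto
  show "root_elation \<Gamma> d q n ?\<theta>"
    unfolding root_elation_def sides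
    using coll stable fixed_side[OF dqn(2) dq ne(1) r(2)] fixed_side[OF dqn(3) dn ne(2) r(3)]
    by blast
qed

lemma transitive_slide_cycle:
  assumes quad: "quadrangle \<Gamma> d q u n" "quadrangle \<Gamma> d q u' n"
  shows "\<exists>s r. opposite \<Delta> b s \<and> opposite \<Delta> s r \<and> opposite \<Delta> r p \<and>
    root_elation \<Gamma> d q n (slide_cycle p b s r) \<and> slide_cycle p b s r u = u'"
proof -
  have tr: "d \<in> trace p b" "q \<in> trace p b" "n \<in> trace p b" "u \<in> trace p b" "u' \<in> trace p b"
    and side: "q \<bottom> d" "n \<bottom> d" "q \<bottom> u" "n \<bottom> u" "q \<bottom> u'" "n \<bottom> u'"
    and du: "\<not> d \<bottom> u" "\<not> d \<bottom> u'"
    using quad collin_sym unfolding quadrangle_iff by auto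
  note p_perp = traceD(3)[OF tr(1)] traceD(3)[OF tr(4)] traceD(3)[OF tr(5)]
  note b_perp = traceD(4)[OF tr(1)] traceD(4)[OF tr(4)]
  have not_pb: "\<not> p \<bottom> b" "\<not> b \<bottom> p" using opposite_not_collin[OF opp] .
  note D = join_line[OF p_perp(1) trace_neq(3)[OF opp tr(1)]]
  obtain s where s: "s \<in> join \<Delta> p d" "s \<noteq> p" "s \<noteq> d" using line_third_point[OF D(1)] .
  have perp_s: "z \<bottom> s" if "z \<bottom> p" "z \<bottom> d" for z
    using perp_line[OF D trace_neq(3)[OF opp tr(1)] that s(1)] .
  have perp_p: "z \<bottom> p" if "z \<bottom> s" "z \<bottom> d" for z
    using perp_line[OF D(1) s(1) D(3) s(3) that D(2)] .
  have perp_d: "z \<bottom> d" if "z \<bottom> s" "z \<bottom> p" for z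
    using perp_line[OF D(1) s(1) D(2) s(2) that D(3)] .
  have bs: "\<not> b \<bottom> s" using perp_p b_perp(1) not_pb(2) by blast
  have s_point: "s \<in> points \<Delta>" using line_points[OF D(1) s(1)] .
  note U = join_line[OF b_perp(2) trace_neq(4)[OF opp tr(4)]]
  note bu = trace_neq(4)[OF opp tr(4)]
  obtain y where y: "y \<in> join \<Delta> b u" "s \<bottom> y"
    using line_meets_perp[OF U(1) s_point] .
  have yb: "y \<noteq> b" using y(2) bs collin_sym by blast
  \<comment> \<open>\<open>u\<close> is the only point of \<open>bu\<close> collinear to
    \<open>p\<close>. If \<open>y\<close> were \<open>u\<close>, it would be collinear to
    \<open>s\<close> and \<open>p\<close>, hence to \<open>d\<close>.\<close>
  have py: "\<not> p \<bottom> y"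
  proof
    assume py: "p \<bottom> y"
    have "y = u"
      using perp_line[OF U(1) y(1) U(3) _ py p_perp(2) U(2)] not_pb(1) by blast
    then show False
      using perp_d[OF collin_sym[OF y(2)] collin_sym[OF py]] du(1) collin_sym by blast
  qed
  \<comment> \<open>\<open>d\<close> is collinear to \<open>b\<close> but not to \<open>u\<close>,
    so \<open>b\<close> is the only point of \<open>bu\<close> collinear to \<open>d\<close>. The
    same argument on \<open>pu'\<close> serves for \<open>v\<close>.\<close>
  have dy: "\<not> d \<bottom> y"
    using perp_line[OF U(1,2) y(1) yb[symmetric] collin_sym[OF b_perp(1)] _ U(3)] du(1) by blast
  note pu' = trace_neq(3)[OF opp tr(5)]
  note U' = join_line[OF p_perp(3) pu']
  have y_point: "y \<in> points \<Delta>" using collin_points(2)[OF y(2)] .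
  obtain v where v: "v \<in> join \<Delta> p u'" "y \<bottom> v"
    using line_meets_perp[OF U'(1) y_point] .
  have vp: "v \<noteq> p" using v(2) py collin_sym by blast
  have p_v: "p \<bottom> v" using line_collin[OF U'(1,2) v(1)] .
  have dv: "\<not> d \<bottom> v"
    using perp_line[OF U'(1,2) v(1) vp[symmetric] collin_sym[OF p_perp(1)] _ U'(3)] du(2) by blast
  have yv: "y \<noteq> v" using py p_v by blast
  note R = join_line[OF v(2) yv]
  obtain r where r: "r \<in> join \<Delta> y v" "d \<bottom> r"
    using line_meets_perp[OF R(1) traceD(5)[OF tr(1)]] .
  \<comment> \<open>\<open>r\<close> is a third point of \<open>yv\<close>, and \<open>v\<close> is
    the only point of that line collinear to \<open>p\<close>; so \<open>r\<close> is opposite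
    \<open>p\<close>.\<close>
  have rv: "r \<noteq> v" and ry: "r \<noteq> y" using r(2) dv dy by blast+
  have "\<not> p \<bottom> r" using perp_line[OF R(1) r(1) R(3) rv _ p_v R(2)] py by blast
  then have rp: "opposite \<Delta> r p"
    using opp line_points[OF R(1) r(1)] collin_sym unfolding opposite_def by blast
  \<comment> \<open>Used for \<open>q\<close> and \<open>n\<close>: \<open>e\<close> is collinear to
    \<open>b\<close> and \<open>u\<close>, hence to \<open>y\<close>; to \<open>p\<close> and
    \<open>u'\<close>, hence to \<open>v\<close>; so to all of \<open>yv\<close>.\<close>
  have perp_r: "r \<bottom> e" if e: "e \<in> trace p b" "e \<bottom> u" "e \<bottom> u'" for e
  proof -
    have "e \<bottom> y" using perp_line[OF U bu traceD(2)[OF e(1)] e(2) y(1)] .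
    moreover have "e \<bottom> v" using perp_line[OF U' pu' traceD(1)[OF e(1)] e(3) v(1)] .
    ultimately show ?thesis using perp_line[OF R yv _ _ r(1)] collin_sym by blast
  qed
  note elation = slide_cycle_root_elation[OF quad(1) s collin_sym[OF r(2)]
      perp_r[OF tr(2) side(3,5)] perp_r[OF tr(3) side(4,6)] rp]
  have not_bs: "\<not> b \<bottom> s" "\<not> s \<bottom> r" "\<not> r \<bottom> p"
    using opposite_not_collin elation(1,2) rp by blast+
  have ry_perp: "r \<bottom> y" "r \<bottom> v" using line_collin[OF R(1) r(1)] R(2,3) by blast+
  have ys: "y \<noteq> s" using ry_perp(1) not_bs(2) collin_sym by blast
  \<comment> \<open>The path of \<open>u\<close>: along \<open>bu\<close> to \<open>y\<close>, which
    is already collinear to \<open>r\<close> and stays; along \<open>ry\<close> to \<open>v\<close>;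
    along \<open>pv\<close> to \<open>u'\<close>.\<close>
  have x1: "slide b s u = y"
    using slide_eqI[OF b_perp(2) bu[symmetric] not_bs(1) y(1) collin_sym[OF y(2)]] .
  have x2: "slide s r y = y"
    using slide_eqI[OF y(2) ys not_bs(2) join_line(3)[OF y(2) ys[symmetric]] collin_sym[OF ry_perp(1)]] .
  have "v \<in> join \<Delta> r y" using join_eq[OF R(1) r(1) R(2) ry] R(3) by simp
  then have x3: "slide r p y = v"
    using slide_eqI[OF ry_perp(1) ry[symmetric] not_bs(3) _ collin_sym[OF p_v]] by blast
  have "u' \<in> join \<Delta> p v" using join_eq[OF U'(1,2) v(1) vp[symmetric]] U'(3) by simp
  then have x4: "slide p b v = u'"
    using slide_eqI[OF p_v vp not_pb(1) _ traceD(2)[OF tr(5)]] by blast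
  have "slide_cycle p b s r u = u'" by (simp add: slide_cycle_def x1 x2 x3 x4)
  then show ?thesis using elation rp by blast
qed

text \<open>Transitivity provides a slide cycle sending \<open>u\<close> to
  \<open>\<theta> u\<close>; rigidity identifies it with \<open>\<theta>\<close> on the whole
  quadrangle.\<close>

lemma root_elation_is_slide_cycle:
  assumes "first_kind_root \<Gamma> d q n" and \<theta>: "root_elation \<Gamma> d q n \<theta>"
  shows "\<exists>s r. opposite \<Delta> b s \<and> opposite \<Delta> s r \<and> opposite \<Delta> r p \<and>
    (\<forall>x\<in>trace p b. \<theta> x = slide_cycle p b s r x)"
proof -
  obtain u where quad: "quadrangle \<Gamma> d q u n" using assms(1) unfolding first_kind_root_def by blast
  have tr: "d \<in> trace p b" "q \<in> trace p b" "u \<in> trace p b" "n \<in> trace p b"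
    and c: "d \<bottom> q" "q \<bottom> u" "u \<bottom> n" "n \<bottom> d" "\<not> d \<bottom> u" "\<not> q \<bottom> n"
    using quad unfolding quadrangle_iff by blast+
  have dn: "d \<bottom> n" using c collin_sym by blast
  have ne: "d \<noteq> q" "d \<noteq> n" using c collin_sym by blast+
  have \<theta>_coll: "collineation \<Gamma> \<theta>" using \<theta> unfolding root_elation_def by blast
  have fixed: "\<theta> d = d" "\<theta> q = q" "\<theta> n = n"
    using \<theta> join_line(2,3)[OF c(1) ne(1)] join_line(2,3)[OF dn ne(2)]
      join_in_quadrangle(2)[OF tr(1,2) c(1) ne(1)] join_in_quadrangle(2)[OF tr(1,4) dn ne(2)]
    unfolding root_elation_def by blast+
  have u': "\<theta> u \<in> trace p b" "q \<bottom> \<theta> u" "\<theta> u \<bottom> n"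
    using collineation_trace[OF \<theta>_coll tr(3)] collineation_collin[OF \<theta>_coll tr(2,3) c(2)]
      collineation_collin[OF \<theta>_coll tr(3,4) c(3)] fixed by simp_all
  \<comment> \<open>Otherwise \<open>\<theta> u\<close> is on \<open>dq\<close> by the absence of
    triangles, so \<open>\<theta>\<close> fixes it; injectivity gives \<open>\<theta> u = u\<close>,
    which is not collinear to \<open>d\<close>.\<close>
  have "\<not> d \<bottom> \<theta> u"
  proof
    assume du': "d \<bottom> \<theta> u"
    note A = join_in_quadrangle(1)[OF tr(1,2) c(1) ne(1)]
    have "\<theta> u \<in> join \<Delta> d q"
      using quadrangle_no_triangle[OF A u'(1) join_line(2,3)[OF c(1) ne(1)] ne(1)] du' u'(2) collin_sym
      by blast
    then have "\<theta> (\<theta> u) = \<theta> u"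
      using \<theta> join_in_quadrangle(2)[OF tr(1,2) c(1) ne(1)] unfolding root_elation_def by blast
    then have "\<theta> u = u" using collineation_inj[OF \<theta>_coll u'(1) tr(3)] by blast
    then show False using du' c(5) by simp
  qed
  then have quad': "quadrangle \<Gamma> d q (\<theta> u) n"
    using tr c u' unfolding quadrangle_iff by blast
  obtain s r where sr: "opposite \<Delta> b s" "opposite \<Delta> s r" "opposite \<Delta> r p"
    "root_elation \<Gamma> d q n (slide_cycle p b s r)" "slide_cycle p b s r u = \<theta> u"
    using transitive_slide_cycle[OF quad quad'] by blast
  interpret agreeing_root_elations \<Delta> p b d q u n \<theta> "slide_cycle p b s r"
    by unfold_locales (use quad \<theta> sr in auto)
  show ?thesis using agree sr by blast
qed

text \<open>Apartments containing the root differ only in the vertex opposite \<open>d\<close> and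
  its two sides, so transitivity on these vertices suffices; joins carry the sides along.\<close>

lemma moufang:
  assumes root: "first_kind_root \<Gamma> d q n"
  shows "moufang_root \<Gamma> d q n"
  unfolding moufang_root_def
proof (intro ballI impI)
  fix A B assume AB: "A \<in> apartments \<Gamma>" "B \<in> apartments \<Gamma>"
    "root_of \<Gamma> d q n \<subseteq> A \<and> root_of \<Gamma> d q n \<subseteq> B"
  obtain u where u: "quadrangle \<Gamma> d q u n" "A = apartment_of \<Gamma> d q u n"
    using apartment_containing_root[OF root AB(1)] AB(3) by blast
  obtain u' where u': "quadrangle \<Gamma> d q u' n" "B = apartment_of \<Gamma> d q u' n"
    using apartment_containing_root[OF root AB(2)] AB(3) by blast
  obtain s r where sr: "root_elation \<Gamma> d q n (slide_cycle p b s r)" "slide_cycle p b s r u = u'"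
    using transitive_slide_cycle[OF u(1) u'(1)] by blast
  let ?\<theta> = "slide_cycle p b s r"
  have coll: "collineation \<Gamma> ?\<theta>" using sr(1) unfolding root_elation_def by blast
  have tr: "d \<in> trace p b" "q \<in> trace p b" "u \<in> trace p b" "n \<in> trace p b"
    and c: "d \<bottom> q" "q \<bottom> u" "u \<bottom> n" "n \<bottom> d" "\<not> d \<bottom> u" "\<not> q \<bottom> n"
    using u(1) unfolding quadrangle_iff by blast+
  have dn: "d \<bottom> n" using c collin_sym by blast
  have ne: "d \<noteq> q" "q \<noteq> u" "u \<noteq> n" "n \<noteq> d"
    using c collin_sym by blast+
  have fixed: "?\<theta> d = d" "?\<theta> q = q" "?\<theta> n = n"
    using sr(1) join_line(2,3)[OF c(1) ne(1)] join_line(2,3)[OF dn ne(4)[symmetric]]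
      join_in_quadrangle(2)[OF tr(1,2) c(1) ne(1)] join_in_quadrangle(2)[OF tr(1,4) dn ne(4)[symmetric]]
    unfolding root_elation_def by blast+
  have "map_sum ?\<theta> (image ?\<theta>) ` A = B"
    unfolding u(2) u'(2) apartment_of_def Plus_def image_Un image_image map_sum.simps
    using collineation_join[OF coll tr(1,2) c(1) ne(1)] collineation_join[OF coll tr(2,3) c(2) ne(2)]
      collineation_join[OF coll tr(3,4) c(3) ne(3)] collineation_join[OF coll tr(4,1) c(4) ne(4)]
      fixed sr(2) by simp
  then show "\<exists>\<theta>. root_elation \<Gamma> d q n \<theta> \<and> map_sum \<theta> (image \<theta>) ` A = B"
    using sr(1) by blast
qed

end

theorem lemma4p4:
  fixes \<Delta> :: "'a geometry" and p b :: 'a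
  assumes "thick_polar_rank3 \<Delta>"
    and "opposite \<Delta> p b"
  shows "(\<forall>d q n. first_kind_root (perp_quadrangle \<Delta> p b) d q n \<longrightarrow>
            moufang_root (perp_quadrangle \<Delta> p b) d q n) \<and>
         (\<forall>d q n \<theta>. first_kind_root (perp_quadrangle \<Delta> p b) d q n \<and>
            root_elation (perp_quadrangle \<Delta> p b) d q n \<theta> \<longrightarrow>
            (\<exists>p0 p1 p2 p3 p4. p0 = p \<and> p4 = p \<and>
               opposite \<Delta> p0 p1 \<and> opposite \<Delta> p1 p2 \<and> opposite \<Delta> p2 p3 \<and> opposite \<Delta> p3 p4 \<and>
               (\<forall>x\<in>points (perp_quadrangle \<Delta> p b).
                  join \<Delta> p (\<theta> x) =
                  (proj \<Delta> p3 p4 \<circ> proj \<Delta> p2 p3 \<circ> proj \<Delta> p1 p2 \<circ> proj \<Delta> p0 p1) (join \<Delta> p x))))"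
proof -
  interpret opposite_points \<Delta> p b
    using assms unfolding thick_polar_rank3_def by unfold_locales auto
  have "\<exists>p0 p1 p2 p3 p4. p0 = p \<and> p4 = p \<and>
      opposite \<Delta> p0 p1 \<and> opposite \<Delta> p1 p2 \<and> opposite \<Delta> p2 p3 \<and> opposite \<Delta> p3 p4 \<and>
      (\<forall>x\<in>points \<Gamma>. join \<Delta> p (\<theta> x) =
        (proj \<Delta> p3 p4 \<circ> proj \<Delta> p2 p3 \<circ> proj \<Delta> p1 p2 \<circ> proj \<Delta> p0 p1) (join \<Delta> p x))"
    if \<theta>: "first_kind_root \<Gamma> d q n" "root_elation \<Gamma> d q n \<theta>" for d q n \<theta>
  proof -
    \<comment> \<open>The base points will be \<open>p0 = p\<close>, \<open>p1 = b\<close>,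
      \<open>p2 = s\<close>, \<open>p3 = r\<close>, \<open>p4 = p\<close>.\<close>
    obtain s r where sr: "opposite \<Delta> b s" "opposite \<Delta> s r" "opposite \<Delta> r p"
      and eq: "\<forall>x\<in>trace p b. \<theta> x = slide_cycle p b s r x"
      using root_elation_is_slide_cycle[OF \<theta>] by blast
    have "\<forall>x\<in>points \<Gamma>. join \<Delta> p (\<theta> x) =
        (proj \<Delta> r p \<circ> proj \<Delta> s r \<circ> proj \<Delta> b s \<circ> proj \<Delta> p b) (join \<Delta> p x)"
      using proj_slide_cycle[OF opp sr] eq unfolding points_quadrangle by simp
    then show ?thesis using opp sr by blast
  qed
  then show ?thesis using moufang by blast
qed

end
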